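(* Let $R$ be a ring and let $A\subseteq B\subseteq C$ be left $R$-modules (each a submodule of the next) with $C/A$ injective. If $B$ is Rad-supplementing, then so is $B/A$.
   Context: Rings are associative with identity and modules are unitary left modules. For a module $M$, $\operatorname{Rad} M$ denotes the radical of $M$ (the intersection of all maximal submodules of $M$, equal to $M$ if there are none). For submodules $U,V$ of a module $N$, $V$ is a Rad-supplement of $U$ in $N$ if $U+V=N$ and $U\cap V\subseteq \operatorname{Rad} V$. A module $M$ is Rad-supplementing if $M$ has a Rad-supplement in every module $N$ that contains $M$ as a submodule. *)

theory Defs
  imports "HOL-Algebra.Module" "HOL-Algebra.AbelCoset"
begin

text \<open>
  The library locale \<open>module\<close> requires a commutative ring of scalars. The following is the same
  locale with \<open>cring\<close> replaced by \<open>ring\<close>. As there, the fields \<open>mult\<close> and \<open>one\<close> of a module record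
  are meaningless. The library locale \<open>submodule\<close> does not presuppose commutativity and is used
  as it is; the module structure of a submodule \<open>V\<close> of \<open>N\<close> is \<open>N\<lparr>carrier := V\<rparr>\<close>.
\<close>

locale left_module = R?: ring R + M?: abelian_group M
  for R :: "('r, 'a) ring_scheme" (structure) and M :: "('r, 'm, 'b) module_scheme" (structure) +
  assumes smult_closed [simp, intro]:
      "\<lbrakk>a \<in> carrier R; x \<in> carrier M\<rbrakk> \<Longrightarrow> a \<odot>\<^bsub>M\<^esub> x \<in> carrier M"
    and smult_l_distr:
      "\<lbrakk>a \<in> carrier R; b \<in> carrier R; x \<in> carrier M\<rbrakk> \<Longrightarrow>
      (a \<oplus> b) \<odot>\<^bsub>M\<^esub> x = a \<odot>\<^bsub>M\<^esub> x \<oplus>\<^bsub>M\<^esub> b \<odot>\<^bsub>M\<^esub> x"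
    and smult_r_distr:
      "\<lbrakk>a \<in> carrier R; x \<in> carrier M; y \<in> carrier M\<rbrakk> \<Longrightarrow>
      a \<odot>\<^bsub>M\<^esub> (x \<oplus>\<^bsub>M\<^esub> y) = a \<odot>\<^bsub>M\<^esub> x \<oplus>\<^bsub>M\<^esub> a \<odot>\<^bsub>M\<^esub> y"
    and smult_assoc1:
      "\<lbrakk>a \<in> carrier R; b \<in> carrier R; x \<in> carrier M\<rbrakk> \<Longrightarrow>
      (a \<otimes> b) \<odot>\<^bsub>M\<^esub> x = a \<odot>\<^bsub>M\<^esub> (b \<odot>\<^bsub>M\<^esub> x)"
    and smult_one [simp]:
      "x \<in> carrier M \<Longrightarrow> \<one> \<odot>\<^bsub>M\<^esub> x = x"

definition module_hom ::
  "('r, 'a) ring_scheme \<Rightarrow> ('r, 'm, 'b) module_scheme \<Rightarrow> ('r, 'n, 'c) module_scheme \<Rightarrow> ('m \<Rightarrow> 'n) set"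
  where "module_hom R M N =
    {f \<in> hom (add_monoid M) (add_monoid N).
       \<forall>r\<in>carrier R. \<forall>x\<in>carrier M. f (r \<odot>\<^bsub>M\<^esub> x) = r \<odot>\<^bsub>N\<^esub> f x}"

text \<open>
  The quotient module. On a coset \<open>X = A + x\<close> the union below is the coset \<open>A + r x\<close>
  (compare \<open>rcoset_mult\<close> in the library).
\<close>

definition quot_module ::
  "('r, 'm, 'b) module_scheme \<Rightarrow> 'm set \<Rightarrow> ('r, 'm set) module"
  where "quot_module M A =
    \<lparr>carrier = a_rcosets\<^bsub>M\<^esub> A, mult = undefined, one = undefined,
     zero = A, add = set_add M,
     smult = (\<lambda>r X. \<Union>x\<in>X. A +>\<^bsub>M\<^esub> (r \<odot>\<^bsub>M\<^esub> x))\<rparr>"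

definition maximal_submodule ::
  "('r, 'a) ring_scheme \<Rightarrow> ('r, 'm, 'b) module_scheme \<Rightarrow> 'm set \<Rightarrow> bool"
  where "maximal_submodule R M K \<longleftrightarrow>
    submodule K R M \<and> K \<noteq> carrier M \<and>
    (\<forall>L. submodule L R M \<longrightarrow> K \<subseteq> L \<longrightarrow> L = K \<or> L = carrier M)"

text \<open>
  Intersecting with \<open>carrier M\<close> only matters if there are no maximal submodules; then
  the radical is all of \<open>M\<close>.
\<close>

definition Rad :: "('r, 'a) ring_scheme \<Rightarrow> ('r, 'm, 'b) module_scheme \<Rightarrow> 'm set"
  where "Rad R M = carrier M \<inter> \<Inter>{K. maximal_submodule R M K}"

definition rad_supplement ::
  "('r, 'a) ring_scheme \<Rightarrow> ('r, 'n, 'b) module_scheme \<Rightarrow> 'n set \<Rightarrow> 'n set \<Rightarrow> bool"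
  where "rad_supplement R N U V \<longleftrightarrow>
    submodule U R N \<and> submodule V R N \<and>
    U <+>\<^bsub>N\<^esub> V = carrier N \<and> U \<inter> V \<subseteq> Rad R (N\<lparr>carrier := V\<rparr>)"

text \<open>
  A formula of HOL cannot quantify over all types, so ``every module'' in the next two definitions
  means every module whose elements are taken from a type \<open>'u\<close>, which plays the role of a universe
  and is passed as an argument. The type of the elements of the module \<open>M\<close> itself need not be
  \<open>'u\<close>; hence ``\<open>N\<close> contains \<open>M\<close> as a submodule'' is rendered by an injective homomorphism
  from \<open>M\<close> into \<open>N\<close>, with \<open>M\<close> identified with its image.
\<close>

definition rad_supplementing ::
  "'u itself \<Rightarrow> ('r, 'a) ring_scheme \<Rightarrow> ('r, 'm, 'b) module_scheme \<Rightarrow> bool"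
  where "rad_supplementing U R M \<longleftrightarrow>
    (\<forall>(N :: ('r, 'u) module) f.
       left_module R N \<longrightarrow> f \<in> module_hom R M N \<longrightarrow> inj_on f (carrier M) \<longrightarrow>
       (\<exists>V. rad_supplement R N (f ` carrier M) V))"

definition injective_module ::
  "'u itself \<Rightarrow> ('r, 'a) ring_scheme \<Rightarrow> ('r, 'm, 'b) module_scheme \<Rightarrow> bool"
  where "injective_module U R E \<longleftrightarrow>
    (\<forall>(Y :: ('r, 'u) module) X f.
       left_module R Y \<longrightarrow> submodule X R Y \<longrightarrow> f \<in> module_hom R (Y\<lparr>carrier := X\<rparr>) E \<longrightarrow>
       (\<exists>g \<in> module_hom R Y E. \<forall>x\<in>X. g x = f x))"

text \<open>
  A universe that is infinite, is large enough for all elements of a ring over \<open>'r\<close> and a module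
  over \<open>'m\<close>, and is as large as one likes, since \<open>'n\<close> is arbitrary. As it has room for the
  ring itself, injectivity relative to it is injectivity without restriction, by Baer's criterion.
  As it is infinite, it also has room for products and quotients of modules that it contains.
\<close>

type_synonym ('r, 'm, 'n) univ = "'r + 'm + 'n + nat"

end

theory Submission
  imports Defs
begin

text \<open>
  Let \<open>f: B/A \<rightarrow> N\<close> be an embedding. As \<open>C/A\<close> is injective, the inclusion \<open>B/A \<subseteq> C/A\<close> extends
  along \<open>f\<close> to a map \<open>g: N \<rightarrow> C/A\<close>. The pullback \<open>P\<close> of \<open>g\<close> and the projection \<open>C \<rightarrow> C/A\<close>
  contains a copy of \<open>B\<close>, and its projection to \<open>N\<close> is surjective, maps \<open>B\<close> onto \<open>f(B/A)\<close> and
  has kernel \<open>A \<subseteq> B\<close>. An epimorphism whose kernel lies in \<open>U\<close> maps a Rad-supplement of \<open>U\<close> to a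
  Rad-supplement of the image of \<open>U\<close>; apply this to a Rad-supplement of \<open>B\<close> in \<open>P\<close>.
\<close>

section \<open>Left modules, submodules and homomorphisms\<close>

text \<open>Negatives come from the scalar -1: (-1)x + x = (-1 + 1)x = 0x. Without cancellation the
  other laws do not force 0x = 0, so \<open>smult_zero\<close> is assumed and stands in for the
  existence of inverses.\<close>

lemma left_moduleI:
  fixes R (structure) and M (structure)
  assumes "ring R"
    and "\<And>x y. \<lbrakk>x \<in> carrier M; y \<in> carrier M\<rbrakk> \<Longrightarrow> x \<oplus>\<^bsub>M\<^esub> y \<in> carrier M"
    and "\<zero>\<^bsub>M\<^esub> \<in> carrier M"
    and "\<And>x y z. \<lbrakk>x \<in> carrier M; y \<in> carrier M; z \<in> carrier M\<rbrakk> \<Longrightarrow>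
      (x \<oplus>\<^bsub>M\<^esub> y) \<oplus>\<^bsub>M\<^esub> z = x \<oplus>\<^bsub>M\<^esub> (y \<oplus>\<^bsub>M\<^esub> z)"
    and "\<And>x y. \<lbrakk>x \<in> carrier M; y \<in> carrier M\<rbrakk> \<Longrightarrow> x \<oplus>\<^bsub>M\<^esub> y = y \<oplus>\<^bsub>M\<^esub> x"
    and "\<And>x. x \<in> carrier M \<Longrightarrow> \<zero>\<^bsub>M\<^esub> \<oplus>\<^bsub>M\<^esub> x = x"
    and smult_closed: "\<And>a x. \<lbrakk>a \<in> carrier R; x \<in> carrier M\<rbrakk> \<Longrightarrow> a \<odot>\<^bsub>M\<^esub> x \<in> carrier M"
    and smult_l_distr: "\<And>a b x. \<lbrakk>a \<in> carrier R; b \<in> carrier R; x \<in> carrier M\<rbrakk> \<Longrightarrow>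
      (a \<oplus> b) \<odot>\<^bsub>M\<^esub> x = a \<odot>\<^bsub>M\<^esub> x \<oplus>\<^bsub>M\<^esub> b \<odot>\<^bsub>M\<^esub> x"
    and "\<And>a x y. \<lbrakk>a \<in> carrier R; x \<in> carrier M; y \<in> carrier M\<rbrakk> \<Longrightarrow>
      a \<odot>\<^bsub>M\<^esub> (x \<oplus>\<^bsub>M\<^esub> y) = a \<odot>\<^bsub>M\<^esub> x \<oplus>\<^bsub>M\<^esub> a \<odot>\<^bsub>M\<^esub> y"
    and "\<And>a b x. \<lbrakk>a \<in> carrier R; b \<in> carrier R; x \<in> carrier M\<rbrakk> \<Longrightarrow>
      (a \<otimes> b) \<odot>\<^bsub>M\<^esub> x = a \<odot>\<^bsub>M\<^esub> (b \<odot>\<^bsub>M\<^esub> x)"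
    and smult_one: "\<And>x. x \<in> carrier M \<Longrightarrow> \<one> \<odot>\<^bsub>M\<^esub> x = x"
    and smult_zero: "\<And>x. x \<in> carrier M \<Longrightarrow> \<zero> \<odot>\<^bsub>M\<^esub> x = \<zero>\<^bsub>M\<^esub>"
  shows "left_module R M"
proof -
  interpret R: ring R by fact
  have "\<exists>y\<in>carrier M. y \<oplus>\<^bsub>M\<^esub> x = \<zero>\<^bsub>M\<^esub>" if x: "x \<in> carrier M" for x
  proof
    show "(\<ominus> \<one>) \<odot>\<^bsub>M\<^esub> x \<in> carrier M" using smult_closed x by simp
    have "(\<ominus> \<one>) \<odot>\<^bsub>M\<^esub> x \<oplus>\<^bsub>M\<^esub> x = (\<ominus> \<one> \<oplus> \<one>) \<odot>\<^bsub>M\<^esub> x"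
      using smult_l_distr[of "\<ominus> \<one>" \<one> x] smult_one x by simp
    then show "(\<ominus> \<one>) \<odot>\<^bsub>M\<^esub> x \<oplus>\<^bsub>M\<^esub> x = \<zero>\<^bsub>M\<^esub>" using smult_zero x R.l_neg by simp
  qed
  then have "abelian_group M" using assms by (intro abelian_groupI)
  with assms show ?thesis by (intro left_module.intro left_module_axioms.intro) auto
qed

context left_module
begin

lemma smult_zero_left [simp]:
  assumes "x \<in> carrier M"
  shows "\<zero> \<odot>\<^bsub>M\<^esub> x = \<zero>\<^bsub>M\<^esub>"
proof -
  have "\<zero> \<odot>\<^bsub>M\<^esub> x \<oplus>\<^bsub>M\<^esub> \<zero> \<odot>\<^bsub>M\<^esub> x = \<zero> \<odot>\<^bsub>M\<^esub> x"
    using smult_l_distr[of \<zero> \<zero> x] assms by simp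
  then show ?thesis using assms by (metis M.add.r_cancel_one' R.zero_closed smult_closed)
qed

lemma smult_minus_one:
  assumes "x \<in> carrier M"
  shows "(\<ominus> \<one>) \<odot>\<^bsub>M\<^esub> x = \<ominus>\<^bsub>M\<^esub> x"
proof -
  have "(\<ominus> \<one>) \<odot>\<^bsub>M\<^esub> x \<oplus>\<^bsub>M\<^esub> x = (\<ominus> \<one> \<oplus> \<one>) \<odot>\<^bsub>M\<^esub> x"
    using smult_l_distr[of "\<ominus> \<one>" \<one> x] assms by simp
  then show ?thesis using assms by (simp add: R.l_neg M.minus_equality)
qed

text \<open>Closure under negation follows from closure under scalars, as -x = (-1)x.\<close>

lemma submoduleI:
  assumes "H \<subseteq> carrier M" "\<zero>\<^bsub>M\<^esub> \<in> H"
    and "\<And>x y. \<lbrakk>x \<in> H; y \<in> H\<rbrakk> \<Longrightarrow> x \<oplus>\<^bsub>M\<^esub> y \<in> H"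
    and smult: "\<And>a x. \<lbrakk>a \<in> carrier R; x \<in> H\<rbrakk> \<Longrightarrow> a \<odot>\<^bsub>M\<^esub> x \<in> H"
  shows "submodule H R M"
proof -
  have "\<ominus>\<^bsub>M\<^esub> x \<in> H" if "x \<in> H" for x
    using smult[of "\<ominus> \<one>" x] smult_minus_one[of x] that assms(1) by auto
  then show ?thesis
    using assms
    by (intro submodule.intro subgroup.intro submodule_axioms.intro) (auto simp: a_inv_def)
qed

lemma submoduleD:
  assumes "submodule H R M"
  shows "H \<subseteq> carrier M" and "\<zero>\<^bsub>M\<^esub> \<in> H"
    and "\<And>x y. \<lbrakk>x \<in> H; y \<in> H\<rbrakk> \<Longrightarrow> x \<oplus>\<^bsub>M\<^esub> y \<in> H"
    and "\<And>a x. \<lbrakk>a \<in> carrier R; x \<in> H\<rbrakk> \<Longrightarrow> a \<odot>\<^bsub>M\<^esub> x \<in> H"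
proof -
  interpret H: submodule H R M by fact
  show "H \<subseteq> carrier M" "\<zero>\<^bsub>M\<^esub> \<in> H"
    and "\<And>x y. \<lbrakk>x \<in> H; y \<in> H\<rbrakk> \<Longrightarrow> x \<oplus>\<^bsub>M\<^esub> y \<in> H"
    and "\<And>a x. \<lbrakk>a \<in> carrier R; x \<in> H\<rbrakk> \<Longrightarrow> a \<odot>\<^bsub>M\<^esub> x \<in> H"
    using H.subset H.one_closed H.m_closed H.smult_closed by auto
qed

lemma submodule_left_module:
  assumes "submodule H R M"
  shows "left_module R (M\<lparr>carrier := H\<rparr>)"
proof -
  have "x \<in> carrier M" if "x \<in> H" for x using submoduleD(1)[OF assms] that by blast
  then show ?thesis
    using submoduleD(2-4)[OF assms]
    by (intro left_moduleI)
      (auto simp: R.ring_axioms M.a_ac smult_l_distr smult_r_distr smult_assoc1)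
qed

lemma submodule_abelian_subgroup:
  assumes "submodule H R M"
  shows "abelian_subgroup H M"
  using assms M.a_comm_group by (intro abelian_subgroupI2) (auto simp: submodule_def)

end

section \<open>Homomorphisms, images and preimages of submodules\<close>

lemma module_homD:
  assumes "f \<in> module_hom R M N"
  shows "\<And>x. x \<in> carrier M \<Longrightarrow> f x \<in> carrier N"
    and "\<And>x y. \<lbrakk>x \<in> carrier M; y \<in> carrier M\<rbrakk> \<Longrightarrow> f (x \<oplus>\<^bsub>M\<^esub> y) = f x \<oplus>\<^bsub>N\<^esub> f y"
    and "\<And>r x. \<lbrakk>r \<in> carrier R; x \<in> carrier M\<rbrakk> \<Longrightarrow> f (r \<odot>\<^bsub>M\<^esub> x) = r \<odot>\<^bsub>N\<^esub> f x"
  using assms by (auto simp: module_hom_def hom_def Pi_iff)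

lemma module_homI:
  assumes "\<And>x. x \<in> carrier M \<Longrightarrow> f x \<in> carrier N"
    and "\<And>x y. \<lbrakk>x \<in> carrier M; y \<in> carrier M\<rbrakk> \<Longrightarrow> f (x \<oplus>\<^bsub>M\<^esub> y) = f x \<oplus>\<^bsub>N\<^esub> f y"
    and "\<And>r x. \<lbrakk>r \<in> carrier R; x \<in> carrier M\<rbrakk> \<Longrightarrow> f (r \<odot>\<^bsub>M\<^esub> x) = r \<odot>\<^bsub>N\<^esub> f x"
  shows "f \<in> module_hom R M N"
  using assms by (auto simp: module_hom_def hom_def Pi_iff)

lemma module_hom_zero:
  assumes "left_module R M" "left_module R N" "f \<in> module_hom R M N"
  shows "f \<zero>\<^bsub>M\<^esub> = \<zero>\<^bsub>N\<^esub>"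
proof -
  interpret M: left_module R M by fact
  interpret N: left_module R N by fact
  have "f (\<zero>\<^bsub>R\<^esub> \<odot>\<^bsub>M\<^esub> \<zero>\<^bsub>M\<^esub>) = \<zero>\<^bsub>R\<^esub> \<odot>\<^bsub>N\<^esub> f \<zero>\<^bsub>M\<^esub>"
    by (intro module_homD(3)[OF assms(3)]) auto
  then show ?thesis by (simp add: module_homD(1)[OF assms(3)])
qed

lemma module_hom_minus:
  assumes "left_module R M" "left_module R N" "f \<in> module_hom R M N" "x \<in> carrier M"
  shows "f (\<ominus>\<^bsub>M\<^esub> x) = \<ominus>\<^bsub>N\<^esub> f x"
proof -
  interpret M: left_module R M by fact
  interpret N: left_module R N by fact
  have "f ((\<ominus>\<^bsub>R\<^esub> \<one>\<^bsub>R\<^esub>) \<odot>\<^bsub>M\<^esub> x) = (\<ominus>\<^bsub>R\<^esub> \<one>\<^bsub>R\<^esub>) \<odot>\<^bsub>N\<^esub> f x"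
    using assms(4) by (intro module_homD(3)[OF assms(3)]) auto
  then show ?thesis
    by (simp add: M.smult_minus_one N.smult_minus_one assms(4) module_homD(1)[OF assms(3)])
qed

lemma module_hom_image_submodule:
  assumes M: "left_module R M" and N: "left_module R N" and f: "f \<in> module_hom R M N"
    and H: "submodule H R M"
  shows "submodule (f ` H) R N"
proof -
  interpret M: left_module R M by fact
  interpret N: left_module R N by fact
  note hD = M.submoduleD[OF H] and fD = module_homD[OF f]
  have c: "x \<in> carrier M" if "x \<in> H" for x using hD(1) that by blast
  show ?thesis
  proof (rule N.submoduleI)
    show "f ` H \<subseteq> carrier N" using c fD(1) by auto
    show "\<zero>\<^bsub>N\<^esub> \<in> f ` H" using module_hom_zero[OF M N f] hD(2) by force
    show "x \<oplus>\<^bsub>N\<^esub> y \<in> f ` H" if "x \<in> f ` H" "y \<in> f ` H" for x y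
      using that c fD(2) hD(3) by (auto simp flip: fD(2))
    show "a \<odot>\<^bsub>N\<^esub> x \<in> f ` H" if "a \<in> carrier R" "x \<in> f ` H" for a x
      using that c hD(4) by (auto simp flip: fD(3))
  qed
qed

lemma module_hom_vimage_submodule:
  assumes M: "left_module R M" and N: "left_module R N" and f: "f \<in> module_hom R M N"
    and K: "submodule K R N"
  shows "submodule {x \<in> carrier M. f x \<in> K} R M"
proof -
  interpret M: left_module R M by fact
  interpret N: left_module R N by fact
  show ?thesis
    using N.submoduleD[OF K] module_homD[OF f] module_hom_zero[OF M N f]
    by (intro M.submoduleI) auto
qed

lemma module_hom_restrict:
  assumes "f \<in> module_hom R M N" "H \<subseteq> carrier M"
  shows "f \<in> module_hom R (M\<lparr>carrier := H\<rparr>) (N\<lparr>carrier := f ` H\<rparr>)"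
  using assms by (intro module_homI) (auto intro: module_homD[OF assms(1)])

section \<open>Epimorphic images of Rad-supplements\<close>

text \<open>One half of the correspondence theorem: a submodule above the preimage of
  \<open>K\<close> contains the kernel, so it is determined by its image, which lies above
  \<open>K\<close>.\<close>

lemma maximal_submodule_vimage:
  assumes M: "left_module R M" and N: "left_module R N" and f: "f \<in> module_hom R M N"
    and surj: "f ` carrier M = carrier N" and K: "maximal_submodule R N K"
  shows "maximal_submodule R M {x \<in> carrier M. f x \<in> K}" (is "maximal_submodule R M ?K")
proof -
  interpret M: left_module R M by fact
  interpret N: left_module R N by fact
  have Ks: "submodule K R N" and Kne: "K \<noteq> carrier N"
    and Kmax: "\<And>L. \<lbrakk>submodule L R N; K \<subseteq> L\<rbrakk> \<Longrightarrow> L = K \<or> L = carrier N"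
    using K by (auto simp: maximal_submodule_def)
  note KD = N.submoduleD[OF Ks]
  \<comment> \<open>By surjectivity \<open>K\<close> is the whole image of its preimage. This puts
    \<open>K\<close> below the image of \<open>L\<close>, and later shows that the preimage is
    proper.\<close>
  have fK: "f ` ?K = K" using KD(1) surj by (auto simp: set_eq_iff image_iff subset_iff) metis
  have "L = ?K \<or> L = carrier M" if L: "submodule L R M" and le: "?K \<subseteq> L" for L
  proof -
    note LD = M.submoduleD[OF L]
    have "submodule (f ` L) R N" by (rule module_hom_image_submodule[OF M N f L])
    moreover have "K \<subseteq> f ` L" using fK le by blast
    ultimately consider "f ` L = K" | "f ` L = carrier N" using Kmax by blast
    then show ?thesis
    proof cases
      case 1
      then show ?thesis using le LD(1) by blast
    next
      case 2
      have "x \<in> L" if x: "x \<in> carrier M" for x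
      proof -
        have "f x \<in> f ` L" using 2 module_homD(1)[OF f x] by simp
        \<comment> \<open>The difference of \<open>x\<close> and \<open>l\<close> is in the kernel,
          hence in the preimage of \<open>K\<close> and so in \<open>L\<close>.\<close>
        then obtain l where l: "l \<in> L" "f x = f l" by blast
        have lM: "l \<in> carrier M" using l LD(1) by blast
        have "f (x \<oplus>\<^bsub>M\<^esub> \<ominus>\<^bsub>M\<^esub> l) = \<zero>\<^bsub>N\<^esub>"
          using x lM l(2) module_homD(1,2)[OF f] module_hom_minus[OF M N f]
          by (simp add: N.M.r_neg)
        then have "x \<oplus>\<^bsub>M\<^esub> \<ominus>\<^bsub>M\<^esub> l \<in> L" using KD(2) le x lM by auto
        then have "(x \<oplus>\<^bsub>M\<^esub> \<ominus>\<^bsub>M\<^esub> l) \<oplus>\<^bsub>M\<^esub> l \<in> L" using l(1) LD(3) by blast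
        then show ?thesis using x lM by (simp add: M.M.a_assoc M.M.l_neg)
      qed
      then show ?thesis using LD(1) by blast
    qed
  qed
  moreover have "?K \<noteq> carrier M" using fK Kne surj by metis
  ultimately show ?thesis
    using module_hom_vimage_submodule[OF M N f Ks] by (auto simp: maximal_submodule_def)
qed

text \<open>An element of the radical lies in every maximal submodule, in particular in the
  preimages of those of \<open>N\<close>.\<close>

lemma module_hom_image_Rad:
  assumes "left_module R M" "left_module R N" "f \<in> module_hom R M N"
    and "f ` carrier M = carrier N"
  shows "f ` Rad R M \<subseteq> Rad R N"
  using maximal_submodule_vimage[OF assms] module_homD(1)[OF assms(3)]
  unfolding Rad_def by blast

text \<open>As the kernel lies in \<open>U\<close>, the image of the intersection of
  \<open>U\<close> and \<open>V\<close> is the intersection of their images. The restriction of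
  \<open>f\<close> to a map from \<open>V\<close> onto its image then carries radical into
  radical.\<close>

lemma module_hom_image_rad_supplement:
  assumes M: "left_module R M" and N: "left_module R N" and f: "f \<in> module_hom R M N"
    and surj: "f ` carrier M = carrier N"
    and ker: "\<And>x. \<lbrakk>x \<in> carrier M; f x = \<zero>\<^bsub>N\<^esub>\<rbrakk> \<Longrightarrow> x \<in> U"
    and sup: "rad_supplement R M U V"
  shows "rad_supplement R N (f ` U) (f ` V)"
proof -
  interpret M: left_module R M by fact
  interpret N: left_module R N by fact
  have U: "submodule U R M" and V: "submodule V R M" and UV: "U <+>\<^bsub>M\<^esub> V = carrier M"
    and UVR: "U \<inter> V \<subseteq> Rad R (M\<lparr>carrier := V\<rparr>)"
    using sup by (auto simp: rad_supplement_def)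
  note UD = M.submoduleD[OF U] and VD = M.submoduleD[OF V] and fD = module_homD[OF f]
  have fU: "submodule (f ` U) R N" and fV: "submodule (f ` V) R N"
    using module_hom_image_submodule[OF M N f] U V by auto
  have Uc: "x \<in> carrier M" if "x \<in> U" for x using that UD(1) by blast
  have Vc: "x \<in> carrier M" if "x \<in> V" for x using that VD(1) by blast
  have "f ` U <+>\<^bsub>N\<^esub> f ` V = f ` (U <+>\<^bsub>M\<^esub> V)"
    using Uc Vc fD(2) by (force simp: set_add_def' image_iff)
  moreover have "f ` U \<inter> f ` V \<subseteq> Rad R (N\<lparr>carrier := f ` V\<rparr>)"
  proof
    fix y assume "y \<in> f ` U \<inter> f ` V"
    \<comment> \<open>The elements \<open>u\<close> and \<open>v\<close> differ by an element of the
      kernel, hence of \<open>U\<close>; so \<open>v\<close> itself lies in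
      \<open>U\<close>.\<close>
    then obtain u v where uv: "u \<in> U" "v \<in> V" "y = f v" "f u = f v" by auto
    have "f (v \<oplus>\<^bsub>M\<^esub> \<ominus>\<^bsub>M\<^esub> u) = \<zero>\<^bsub>N\<^esub>"
      using uv Uc Vc fD(1,2) module_hom_minus[OF M N f] by (simp add: N.M.r_neg)
    then have "v \<oplus>\<^bsub>M\<^esub> \<ominus>\<^bsub>M\<^esub> u \<in> U" using ker uv Uc Vc by simp
    then have "(v \<oplus>\<^bsub>M\<^esub> \<ominus>\<^bsub>M\<^esub> u) \<oplus>\<^bsub>M\<^esub> u \<in> U" using uv UD(3) by blast
    then have "v \<in> U" using uv Uc Vc by (simp add: M.M.a_assoc M.M.l_neg)
    then have "v \<in> Rad R (M\<lparr>carrier := V\<rparr>)" using UVR uv by blast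
    moreover have "f ` Rad R (M\<lparr>carrier := V\<rparr>) \<subseteq> Rad R (N\<lparr>carrier := f ` V\<rparr>)"
      by (intro module_hom_image_Rad M.submodule_left_module N.submodule_left_module V fV
            module_hom_restrict f VD(1)) simp
    ultimately show "y \<in> Rad R (N\<lparr>carrier := f ` V\<rparr>)" using uv(3) by blast
  qed
  ultimately show ?thesis using fU fV UV surj by (simp add: rad_supplement_def)
qed

section \<open>Change of universe\<close>

text \<open>Transport of structure along \<open>h\<close>. For injective \<open>h\<close>,
  \<open>inv_into UNIV h\<close> is its inverse on the range, and the result is an isomorphic copy
  of \<open>M\<close>.\<close>

definition image_module :: "('m \<Rightarrow> 'n) \<Rightarrow> ('r, 'm, 'b) module_scheme \<Rightarrow> ('r, 'n) module"
  where "image_module h M =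
    \<lparr>carrier = h ` carrier M, mult = undefined, one = undefined, zero = h \<zero>\<^bsub>M\<^esub>,
     add = (\<lambda>x y. h (inv_into UNIV h x \<oplus>\<^bsub>M\<^esub> inv_into UNIV h y)),
     smult = (\<lambda>r x. h (r \<odot>\<^bsub>M\<^esub> inv_into UNIV h x))\<rparr>"

lemma left_module_image_module:
  assumes "left_module R M" "inj h"
  shows "left_module R (image_module h M)"
proof -
  interpret M: left_module R M by fact
  show ?thesis
    by (rule left_moduleI)
      (auto simp: image_module_def inv_f_f[OF assms(2)] M.R.ring_axioms M.M.a_ac
        M.smult_l_distr M.smult_r_distr M.smult_assoc1)
qed

text \<open>A module over the smaller type is copied into the larger one, and the Rad-supplement
  found there is carried back by the inverse of \<open>h\<close>, an epimorphism with zero kernel.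
  This allows test modules whose elements are pairs.\<close>

lemma rad_supplementing_universe:
  fixes h :: "'v \<Rightarrow> 'u"
  assumes h: "inj h" and M: "rad_supplementing TYPE('u) R M"
  shows "rad_supplementing TYPE('v) R M"
  unfolding rad_supplementing_def
proof (intro allI impI)
  fix N :: "('a, 'v) module" and f
  assume N: "left_module R N" and f: "f \<in> module_hom R M N" and inj: "inj_on f (carrier M)"
  let ?N = "image_module h N"
  interpret N: left_module R N by fact
  have N': "left_module R ?N" by (rule left_module_image_module[OF N h])
  have "h \<circ> f \<in> module_hom R M ?N"
    using module_homD[OF f] by (intro module_homI) (auto simp: image_module_def inv_f_f[OF h])
  moreover have "inj_on (h \<circ> f) (carrier M)"
    using inj h by (auto intro!: comp_inj_on intro: inj_on_subset)
  ultimately obtain V where V: "rad_supplement R ?N ((h \<circ> f) ` carrier M) V"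
    using M N' unfolding rad_supplementing_def by blast
  have "inv_into UNIV h \<in> module_hom R ?N N"
    by (intro module_homI) (auto simp: image_module_def inv_f_f[OF h])
  moreover have "inv_into UNIV h ` carrier ?N = carrier N"
    by (simp add: image_module_def image_image inv_f_f[OF h])
  \<comment> \<open>The kernel condition for the inverse of \<open>h\<close>: only zero is sent to
    zero, and zero lies in the image of \<open>M\<close> because that is a submodule.\<close>
  moreover have "x \<in> (h \<circ> f) ` carrier M"
    if "x \<in> carrier ?N" "inv_into UNIV h x = \<zero>\<^bsub>N\<^esub>" for x
  proof -
    have "x = \<zero>\<^bsub>?N\<^esub>" using that by (auto simp: image_module_def inv_f_f[OF h])
    moreover have "\<zero>\<^bsub>?N\<^esub> \<in> (h \<circ> f) ` carrier M"
      using V left_module.submoduleD(2)[OF N'] by (auto simp: rad_supplement_def)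
    ultimately show ?thesis by simp
  qed
  ultimately have "rad_supplement R N (inv_into UNIV h ` (h \<circ> f) ` carrier M)
      (inv_into UNIV h ` V)"
    using module_hom_image_rad_supplement[OF N' N] V by blast
  then show "\<exists>V. rad_supplement R N (f ` carrier M) V"
    by (auto simp: image_image inv_f_f[OF h])
qed

text \<open>The universe is infinite, hence in bijection with its square, and it contains a copy of
  \<open>'m\<close> as its second summand.\<close>

lemma ex_inj_univ_times:
  "\<exists>h :: ('r, 'm, 'n) univ \<times> 'm \<Rightarrow> ('r, 'm, 'n) univ. inj h"
proof -
  let ?U = "UNIV :: ('r, 'm, 'n) univ set"
  let ?i = "map_prod id (Inr \<circ> Inl) :: ('r, 'm, 'n) univ \<times> 'm \<Rightarrow> _ \<times> ('r, 'm, 'n) univ"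
  have "infinite ?U" by simp
  then obtain e where e: "bij_betw e (?U \<times> ?U) ?U"
    using card_of_ordIso card_of_Times_same_infinite by metis
  have "inj e" using e by (simp add: bij_betw_def)
  moreover have "inj ?i" by (intro prod.inj_map inj_compose) auto
  ultimately have "inj (e \<circ> ?i)" by (rule inj_compose)
  then show ?thesis by (rule exI[of inj])
qed

section \<open>The pullback\<close>

definition prod_module ::
  "('r, 'm, 'b) module_scheme \<Rightarrow> ('r, 'n, 'c) module_scheme \<Rightarrow> ('r, 'm \<times> 'n) module"
  where "prod_module M N =
    \<lparr>carrier = carrier M \<times> carrier N, mult = undefined, one = undefined,
     zero = (\<zero>\<^bsub>M\<^esub>, \<zero>\<^bsub>N\<^esub>), add = (\<lambda>x y. (fst x \<oplus>\<^bsub>M\<^esub> fst y, snd x \<oplus>\<^bsub>N\<^esub> snd y)),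
     smult = (\<lambda>r x. (r \<odot>\<^bsub>M\<^esub> fst x, r \<odot>\<^bsub>N\<^esub> snd x))\<rparr>"

lemma left_module_prod_module:
  assumes "left_module R M" "left_module R N"
  shows "left_module R (prod_module M N)"
proof -
  interpret M: left_module R M by fact
  interpret N: left_module R N by fact
  show ?thesis
    by (rule left_moduleI)
      (auto simp: prod_module_def M.R.ring_axioms M.M.a_assoc N.M.a_assoc
        M.smult_l_distr M.smult_r_distr M.smult_assoc1
        N.smult_l_distr N.smult_r_distr N.smult_assoc1 intro: M.M.a_comm N.M.a_comm)
qed

section \<open>Quotient modules\<close>

lemma carrier_quot_module: "carrier (quot_module M A) = (\<lambda>x. A +>\<^bsub>M\<^esub> x) ` carrier M"
  by (auto simp: quot_module_def A_RCOSETS_def')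

lemma add_quot_module: "X \<oplus>\<^bsub>quot_module M A\<^esub> Y = X <+>\<^bsub>M\<^esub> Y"
  by (simp add: quot_module_def)

text \<open>The operations on cosets do not refer to the carrier, so passing to \<open>H\<close>
  only changes which cosets are present. Thus B/A is literally a restriction of C/A, and its
  inclusion is the identity on cosets.\<close>

lemma quot_module_submodule:
  "quot_module (M\<lparr>carrier := H\<rparr>) A = (quot_module M A)\<lparr>carrier := (\<lambda>x. A +>\<^bsub>M\<^esub> x) ` H\<rparr>"
  by (auto simp: quot_module_def A_RCOSETS_def' a_r_coset_def' set_add_def' fun_eq_iff)

text \<open>If y = a + x with a in \<open>A\<close>, then ry = ra + rx with ra in \<open>A\<close>.
  So all cosets in the union defining the scalar multiple agree, and the union is not empty, as
  \<open>x\<close> lies in its own coset.\<close>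

lemma smult_coset:
  assumes M: "left_module R M" and A: "submodule A R M" and r: "r \<in> carrier R"
    and x: "x \<in> carrier M"
  shows "r \<odot>\<^bsub>quot_module M A\<^esub> (A +>\<^bsub>M\<^esub> x) = A +>\<^bsub>M\<^esub> (r \<odot>\<^bsub>M\<^esub> x)"
proof -
  interpret M: left_module R M by fact
  interpret A: abelian_subgroup A M by (rule M.submodule_abelian_subgroup[OF A])
  note AD = M.submoduleD[OF A]
  have "A +>\<^bsub>M\<^esub> (r \<odot>\<^bsub>M\<^esub> y) = A +>\<^bsub>M\<^esub> (r \<odot>\<^bsub>M\<^esub> x)" if y: "y \<in> A +>\<^bsub>M\<^esub> x" for y
  proof -
    obtain a where a: "a \<in> A" "y = a \<oplus>\<^bsub>M\<^esub> x" using y by (auto simp: a_r_coset_def')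
    have "r \<odot>\<^bsub>M\<^esub> y = r \<odot>\<^bsub>M\<^esub> a \<oplus>\<^bsub>M\<^esub> r \<odot>\<^bsub>M\<^esub> x"
      using a AD(1) r x by (auto simp: M.smult_r_distr)
    then have "r \<odot>\<^bsub>M\<^esub> y \<in> A +>\<^bsub>M\<^esub> (r \<odot>\<^bsub>M\<^esub> x)"
      using AD(4) a(1) r by (auto simp: a_r_coset_def')
    then show ?thesis using A.a_repr_independence' r x by auto
  qed
  then have "(\<Union>y\<in>A +>\<^bsub>M\<^esub> x. A +>\<^bsub>M\<^esub> (r \<odot>\<^bsub>M\<^esub> y)) = A +>\<^bsub>M\<^esub> (r \<odot>\<^bsub>M\<^esub> x)"
    by (intro UN_constant_eq[OF A.a_rcos_self[OF x]] ballI)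
  then show ?thesis by (simp add: quot_module_def)
qed

lemma coset_hom:
  assumes M: "left_module R M" and A: "submodule A R M"
  shows "(\<lambda>x. A +>\<^bsub>M\<^esub> x) \<in> module_hom R M (quot_module M A)"
proof -
  interpret M: left_module R M by fact
  interpret A: abelian_subgroup A M by (rule M.submodule_abelian_subgroup[OF A])
  show ?thesis
    using A.a_rcos_sum smult_coset[OF M A]
    by (intro module_homI) (simp_all add: carrier_quot_module add_quot_module)
qed

text \<open>
  An element \<open>X\<close> of \<open>C/A\<close> is a coset, so \<open>c \<in> X\<close> says that \<open>c\<close> is mapped to \<open>X\<close> by the projection
  of \<open>C\<close> onto \<open>C/A\<close>; hence the set below is the pullback.
\<close>

lemma pullback_submodule:
  assumes N: "left_module R N" and C: "left_module R C" and A: "submodule A R C"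
    and g: "g \<in> module_hom R N (quot_module C A)" and g0: "g \<zero>\<^bsub>N\<^esub> = A"
  shows "submodule {(n, c). n \<in> carrier N \<and> c \<in> g n} R (prod_module N C)"
proof -
  interpret N: left_module R N by fact
  interpret C: left_module R C by fact
  interpret P: left_module R "prod_module N C" by (rule left_module_prod_module[OF N C])
  interpret A: abelian_subgroup A C by (rule C.submodule_abelian_subgroup[OF A])
  note gD = module_homD[OF g] and AD = C.submoduleD[OF A]
  have gc: "\<exists>c\<in>carrier C. g n = A +>\<^bsub>C\<^esub> c" if "n \<in> carrier N" for n
    using gD(1)[OF that] by (auto simp: carrier_quot_module)
  have gsub: "c \<in> carrier C" if "n \<in> carrier N" "c \<in> g n" for n c
    using gc[OF that(1)] that(2) C.M.a_r_coset_subset_G[OF AD(1)] by auto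
  have gadd: "c \<oplus>\<^bsub>C\<^esub> d \<in> g (n \<oplus>\<^bsub>N\<^esub> m)"
    if "n \<in> carrier N" "m \<in> carrier N" "c \<in> g n" "d \<in> g m" for n m c d
    using that gD(2)[OF that(1,2)] by (auto simp: add_quot_module set_add_def')
  have gsmult: "r \<odot>\<^bsub>C\<^esub> c \<in> g (r \<odot>\<^bsub>N\<^esub> n)"
    if "r \<in> carrier R" "n \<in> carrier N" "c \<in> g n" for r n c
  proof -
    \<comment> \<open>The coset of rc is one of those united in the scalar multiple of the coset
      \<open>g n\<close>.\<close>
    have "r \<odot>\<^bsub>C\<^esub> c \<in> A +>\<^bsub>C\<^esub> (r \<odot>\<^bsub>C\<^esub> c)" using gsub that by (intro A.a_rcos_self) auto
    then show ?thesis using gD(3)[OF that(1,2)] that(3) by (auto simp: quot_module_def)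
  qed
  show ?thesis
    using gsub gadd gsmult g0 AD(2)
    by (intro P.submoduleI) (auto simp: prod_module_def)
qed

theorem proposition2p17:
  fixes R :: "'r ring" and C :: "('r, 'm) module" and A B :: "'m set"
  assumes "ring R"
    and "left_module R C"
    and "submodule B R C"
    and "submodule A R (C\<lparr>carrier := B\<rparr>)"
    and "injective_module TYPE(('r, 'm, 'n) univ) R (quot_module C A)"
    and "rad_supplementing TYPE(('r, 'm, 'n) univ) R (C\<lparr>carrier := B\<rparr>)"
  shows "rad_supplementing TYPE(('r, 'm, 'n) univ) R (quot_module (C\<lparr>carrier := B\<rparr>) A)"
  unfolding rad_supplementing_def
proof (intro allI impI)
  let ?B = "C\<lparr>carrier := B\<rparr>"
  let ?Q = "quot_module ?B A"
  fix N :: "('r, ('r, 'm, 'n) univ) module" and f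
  assume N: "left_module R N" and f: "f \<in> module_hom R ?Q N" and inj: "inj_on f (carrier ?Q)"
  interpret C: left_module R C by fact
  interpret N: left_module R N by fact
  note BD = C.submoduleD[OF assms(3)]
  have B: "left_module R ?B" by (rule C.submodule_left_module[OF assms(3)])
  note AB = left_module.submoduleD[OF B assms(4)]
  have A: "submodule A R C" using AB BD by (intro C.submoduleI) auto
  interpret A: abelian_subgroup A C by (rule C.submodule_abelian_subgroup[OF A])
  have Qc: "carrier ?Q = (\<lambda>b. A +>\<^bsub>C\<^esub> b) ` B"
    by (simp add: quot_module_submodule)
  have Bc: "b \<in> carrier C" if "b \<in> B" for b using BD(1) that by blast
  note fD = module_homD[OF f]
  \<comment> \<open>The composite of the projection from \<open>B\<close> onto B/A with
    \<open>f\<close>; its image is that of \<open>f\<close>, and it vanishes on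
    \<open>A\<close>.\<close>
  define j where "j b = f (A +>\<^bsub>C\<^esub> b)" for b
  have j: "j \<in> module_hom R ?B N"
  proof -
    have q: "(\<lambda>b. A +>\<^bsub>C\<^esub> b) \<in> module_hom R ?B ?Q"
      using module_hom_restrict[OF coset_hom[OF assms(2) A] BD(1)]
      by (simp add: quot_module_submodule)
    show ?thesis
      using module_homD[OF q] fD by (intro module_homI) (simp_all add: j_def)
  qed
  have fX: "f ` carrier ?Q = j ` B" by (simp add: Qc j_def image_image)
  have X: "submodule (f ` carrier ?Q) R N"
    unfolding fX using BD
    by (intro module_hom_image_submodule[OF B N j] left_module.submoduleI[OF B]) auto
  have inv_f: "inv_into (carrier ?Q) f (j b) = A +>\<^bsub>C\<^esub> b" if "b \<in> B" for b
    unfolding j_def using that by (intro inv_into_f_f[OF inj]) (auto simp: Qc)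
  \<comment> \<open>The map to be extended: the inverse of \<open>f\<close> on its image, followed
    by the inclusion of B/A in C/A.\<close>
  have "inv_into (carrier ?Q) f \<in> module_hom R (N\<lparr>carrier := f ` carrier ?Q\<rparr>) (quot_module C A)"
    using module_homD[OF coset_hom[OF assms(2) A]] BD(3,4) Bc
    by (intro module_homI)
      (auto simp: fX inv_f simp flip: module_homD(2,3)[OF j, simplified])
  then obtain g where g: "g \<in> module_hom R N (quot_module C A)"
    and g_ext: "\<And>x. x \<in> f ` carrier ?Q \<Longrightarrow> g x = inv_into (carrier ?Q) f x"
    using assms(5) N X unfolding injective_module_def by blast
  have gj: "g (j b) = A +>\<^bsub>C\<^esub> b" if "b \<in> B" for b
    using g_ext[of "j b"] inv_f[OF that] that by (auto simp: fX)
  \<comment> \<open>Zero of \<open>N\<close> is \<open>j\<close> of zero, where \<open>g\<close> is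
    already known to be the coset of zero, which is \<open>A\<close>.\<close>
  have g0: "g \<zero>\<^bsub>N\<^esub> = A"
    using gj[OF BD(2)] module_hom_zero[OF B N j] A.a_rcos_const[OF AB(2)] by simp
  define P where "P = (prod_module N C)\<lparr>carrier := {(n, c). n \<in> carrier N \<and> c \<in> g n}\<rparr>"
  have P: "left_module R P"
    unfolding P_def
    by (rule left_module.submodule_left_module[OF left_module_prod_module[OF N assms(2)]
          pullback_submodule[OF N assms(2) A g g0]])
  have fst_hom: "fst \<in> module_hom R P N"
    by (rule module_homI) (auto simp: P_def prod_module_def)
  have fst_surj: "fst ` carrier P = carrier N"
  proof -
    have "\<exists>c. c \<in> g n" if "n \<in> carrier N" for n
      using module_homD(1)[OF g that] A.a_rcos_self by (auto simp: carrier_quot_module)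
    then show ?thesis by (force simp: P_def image_iff)
  qed
  \<comment> \<open>The copy of \<open>B\<close> in the pullback: \<open>b\<close> lies in its own
    coset, which is \<open>g (j b)\<close>, and the second component makes the map
    injective.\<close>
  let ?i = "\<lambda>b. (j b, b)"
  have i: "?i \<in> module_hom R ?B P"
    using module_homD[OF j] gj A.a_rcos_self Bc
    by (intro module_homI) (auto simp: P_def prod_module_def)
  moreover have "inj_on ?i (carrier ?B)" by (auto simp: inj_on_def)
  moreover obtain h :: "('r, 'm, 'n) univ \<times> 'm \<Rightarrow> ('r, 'm, 'n) univ" where "inj h"
    using ex_inj_univ_times by blast
  ultimately obtain V where V: "rad_supplement R P (?i ` carrier ?B) V"
    using rad_supplementing_universe[OF _ assms(6)] P unfolding rad_supplementing_def by blast
  have jA: "j a = \<zero>\<^bsub>N\<^esub>" if "a \<in> A" for a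
    using A.a_rcos_const[OF that] A.a_rcos_const[OF AB(2)] module_hom_zero[OF B N j]
    by (simp add: j_def)
  \<comment> \<open>A pair in the kernel is (0, c) with \<open>c\<close> in \<open>g\<close> of
    zero, that is, in \<open>A\<close>. There \<open>j\<close> vanishes, so the pair is the copy of
    the element \<open>c\<close> of \<open>B\<close>.\<close>
  have "x \<in> ?i ` carrier ?B" if "x \<in> carrier P" "fst x = \<zero>\<^bsub>N\<^esub>" for x
    using that g0 jA AB(1) by (auto simp: P_def image_iff)
  then have "rad_supplement R N (fst ` ?i ` carrier ?B) (fst ` V)"
    by (rule module_hom_image_rad_supplement[OF P N fst_hom fst_surj _ V])
  \<comment> \<open>The first projection sends the copy of \<open>b\<close> to \<open>j b\<close>,
    so the image of the copy of \<open>B\<close> is the image of \<open>f\<close>.\<close>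
  then show "\<exists>V. rad_supplement R N (f ` carrier ?Q) V"
    by (auto simp: image_image fX)
qed

end
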